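(* Let $(E,\mathcal L,\overline{\mathcal E})$ be a set-finite, receiver set-finite, weakly left-resolving labelled space, where $E$ has no sinks, such that for every $v\in E^0$ the generalized vertex $[v]_l$ is finite for some $l\geq1$. Let $(F,\mathcal L_F,\overline{\mathcal F})$ be the merged labelled space of $(E,\mathcal L,\overline{\mathcal E})$. Then: (i) $(E,\mathcal L,\overline{\mathcal E})$ is strongly cofinal if and only if $(F,\mathcal L_F,\overline{\mathcal F})$ is strongly cofinal. (ii) $(E,\mathcal L,\overline{\mathcal E})$ is disagreeable if and only if $(F,\mathcal L_F,\overline{\mathcal F})$ is disagreeable.
   Context: Labelled spaces. A directed graph $E=(E^0,E^1,r,s)$ has countable sets $E^0$ (vertices), $E^1$ (edges) and range, source maps $r,s:E^1\to E^0$; $E$ has no sinks if every vertex emits an edge. $E^n$ is the set of paths $\lambda=\lambda_1\cdots\lambda_n$ ($r(\lambda_i)=s(\lambda_{i+1})$), $E^{\le l}=\bigcup_{i=1}^lE^i$, $E^{\ge n}=\bigcup_{i\ge n}E^i$, $E^\infty$ is the set of infinite paths; $r,s$ extend to finite paths, $s$ to infinite paths. A labelled graph $(E,\mathcal L)$ over a countable alphabet $\mathcal A$ has a surjective labelling map $\mathcal L:E^1\to\mathcal A$, extended to finite and infinite paths by concatenation; $\mathcal L^*(E)=\mathcal L(E^{\ge1})$. For $\alpha\in\mathcal L^*(E)$ and $A\subset E^0$, $r(\alpha)=\{r(\lambda):\mathcal L(\lambda)=\alpha\}$ and $r(A,\alpha)=\{r(\lambda):\mathcal L(\lambda)=\alpha,\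 s(\lambda)\in A\}$. For $x\in\mathcal L(E^\infty)$, $s(x)=\{s(\delta):\delta\in E^\infty,\mathcal L(\delta)=x\}$. $AE^{n}$ (resp. $AE^{\ge n}$) is the set of paths in $E^n$ (resp. $E^{\ge n}$) with source in $A$; $E^nA$ the set of paths in $E^n$ with range in $A$. A collection $\mathcal B\subset 2^{E^0}$ is accommodating if it contains $r(\alpha)$ for all $\alpha\in\mathcal L^*(E)$ and is closed under $A\mapsto r(A,\alpha)$, finite unions and finite intersections; then $(E,\mathcal L,\mathcal B)$ is a labelled space. It is weakly left-resolving if $r(A,\alpha)\cap r(B,\alpha)=r(A\cap B,\alpha)$ for all $A,B\in\mathcal B$, $\alpha\in\mathcal L^*(E)$; set-finite (receiver set-finite) if $\mathcal L(AE^1)$ ($\mathcal L(E^1A)$) is finite for all $A\in\mathcal B$. Generalized vertices and $\overline{\mathcal E}$. For $v,w\in E^0$, $v\sim_lw$ iff $\mathcal L(E^{\le l}v)=\mathcal L(E^{\le l}w)$, where $E^{\le l}v$ is the set of paths in $E^{\le l}$ with range $v$; $[v]_l$ is the $\sim_l$-class of $v$, called a generalized vertex. $\overline{\mathcal E}$ is the smallest accommodating set for $(E,\mathcal L)$ that is closed under relative complements; throughout it is understood that $\overline{\mathcal E}$ contains all generalized vertices $[v]_l$, $v\in E^0$, $l\ge1$ (equivalently, $\overline{\mathcal E}$ is the smallest accommodating set containing all generalized vertices). Merged labelled graph. Write $v\sim w$ iff $[v]_l=[w]_l$ for all $l\ge1$, and let $[v]_\infty$ be the $\sim$-class of $v$.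 $F^0=\{[v]_\infty:v\in E^0\}$. Each $\lambda\in E^1$ gives an edge $e_\lambda$ of $F$ from $[s(\lambda)]_\infty$ to $[r(\lambda)]_\infty$ with label $\mathcal L_F(e_\lambda)=\mathcal L(\lambda)$; two edges with the same source, range and label are identified. $F^1=\{e_\lambda:\lambda\in E^1\}$, and $(F,\mathcal L_F)$ is the merged labelled graph of $(E,\mathcal L)$. $\overline{\mathcal F}$ is the smallest accommodating set for $(F,\mathcal L_F)$ closed under relative complements; $(F,\mathcal L_F,\overline{\mathcal F})$ is the merged labelled space. Properties (defined for $(E,\mathcal L,\overline{\mathcal E})$, and in the same way for $(F,\mathcal L_F,\overline{\mathcal F})$). It is disagreeable if for each generalized vertex $[v]_l$ there exists $N\ge1$ such that for all $n\ge N$ there is a labelled path $\alpha\in\mathcal L([v]_lE^{\ge n})$ that is not agreeable, i.e. not of the form $\alpha=\beta\alpha'=\alpha'\gamma$ for some $\alpha',\beta,\gamma\in\mathcal L(E^{\ge1})$ with $|\beta|=|\gamma|\le l$. It is strongly cofinal if for all $x=x_1x_2\cdots\in\mathcal L(E^\infty)$, $w\in s(x)$, and every generalized vertex $[v]_l$, there are $N\ge1$ and finitely many labelled paths $\lambda_1,\dots,\lambda_m$ such that $r([w]_1,x_1\cdots x_N)\subset\bigcup_{i=1}^mr([v]_l,\lambda_i)$. *)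

theory Defs
  imports "HOL-Library.Countable_Set"
begin

record ('v, 'e, 'a) lgraph =
  verts :: "'v set"
  edges :: "'e set"
  rng :: "'e \<Rightarrow> 'v"
  src :: "'e \<Rightarrow> 'v"
  alphabet :: "'a set"
  lab :: "'e \<Rightarrow> 'a"

definition labelled_graph :: "('v, 'e, 'a) lgraph \<Rightarrow> bool" where
  "labelled_graph G \<longleftrightarrow>
     countable (verts G) \<and> countable (edges G) \<and> countable (alphabet G) \<and>
     rng G ` edges G \<subseteq> verts G \<and> src G ` edges G \<subseteq> verts G \<and>
     lab G ` edges G = alphabet G"

definition no_sinks :: "('v, 'e, 'a) lgraph \<Rightarrow> bool" where
  "no_sinks G \<longleftrightarrow> (\<forall>v\<in>verts G. \<exists>e\<in>edges G. src G e = v)"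

text \<open>Paths have length at least one; vertices are not paths. Thus \<open>paths\<close> is $E^{\ge 1}$, and
  $E^n$, $E^{\le l}$, $E^{\ge n}$ are obtained from it by restricting the length.\<close>

definition paths :: "('v, 'e, 'a) lgraph \<Rightarrow> 'e list set" where
  "paths G = {p. p \<noteq> [] \<and> set p \<subseteq> edges G \<and>
     (\<forall>i. Suc i < length p \<longrightarrow> rng G (p ! i) = src G (p ! Suc i))}"

definition inf_paths :: "('v, 'e, 'a) lgraph \<Rightarrow> (nat \<Rightarrow> 'e) set" where
  "inf_paths G = {d. \<forall>i. d i \<in> edges G \<and> rng G (d i) = src G (d (Suc i))}"

definition psrc :: "('v, 'e, 'a) lgraph \<Rightarrow> 'e list \<Rightarrow> 'v" where
  "psrc G p = src G (hd p)"

definition prng :: "('v, 'e, 'a) lgraph \<Rightarrow> 'e list \<Rightarrow> 'v" where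
  "prng G p = rng G (last p)"

definition plab :: "('v, 'e, 'a) lgraph \<Rightarrow> 'e list \<Rightarrow> 'a list" where
  "plab G p = map (lab G) p"

definition labelled_paths :: "('v, 'e, 'a) lgraph \<Rightarrow> 'a list set" where
  "labelled_paths G = plab G ` paths G"

definition inf_labelled_paths :: "('v, 'e, 'a) lgraph \<Rightarrow> (nat \<Rightarrow> 'a) set" where
  "inf_labelled_paths G = (\<lambda>d. lab G \<circ> d) ` inf_paths G"

definition path_range :: "('v, 'e, 'a) lgraph \<Rightarrow> 'a list \<Rightarrow> 'v set" where
  "path_range G \<alpha> = prng G ` {p \<in> paths G. plab G p = \<alpha>}"

definition rel_range :: "('v, 'e, 'a) lgraph \<Rightarrow> 'v set \<Rightarrow> 'a list \<Rightarrow> 'v set" where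
  "rel_range G A \<alpha> = prng G ` {p \<in> paths G. plab G p = \<alpha> \<and> psrc G p \<in> A}"

definition inf_source :: "('v, 'e, 'a) lgraph \<Rightarrow> (nat \<Rightarrow> 'a) \<Rightarrow> 'v set" where
  "inf_source G x = {src G (d 0) | d. d \<in> inf_paths G \<and> lab G \<circ> d = x}"

definition accommodating :: "('v, 'e, 'a) lgraph \<Rightarrow> 'v set set \<Rightarrow> bool" where
  "accommodating G \<B> \<longleftrightarrow>
     \<B> \<subseteq> Pow (verts G) \<and>
     (\<forall>\<alpha>\<in>labelled_paths G. path_range G \<alpha> \<in> \<B>) \<and>
     (\<forall>A\<in>\<B>. \<forall>\<alpha>\<in>labelled_paths G. rel_range G A \<alpha> \<in> \<B>) \<and>
     (\<forall>A\<in>\<B>. \<forall>B\<in>\<B>. A \<union> B \<in> \<B>) \<and>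
     (\<forall>A\<in>\<B>. \<forall>B\<in>\<B>. A \<inter> B \<in> \<B>)"

definition labelled_space :: "('v, 'e, 'a) lgraph \<Rightarrow> 'v set set \<Rightarrow> bool" where
  "labelled_space G \<B> \<longleftrightarrow> labelled_graph G \<and> accommodating G \<B>"

definition weakly_left_resolving :: "('v, 'e, 'a) lgraph \<Rightarrow> 'v set set \<Rightarrow> bool" where
  "weakly_left_resolving G \<B> \<longleftrightarrow>
     (\<forall>A\<in>\<B>. \<forall>B\<in>\<B>. \<forall>\<alpha>\<in>labelled_paths G.
        rel_range G A \<alpha> \<inter> rel_range G B \<alpha> = rel_range G (A \<inter> B) \<alpha>)"

definition set_finite :: "('v, 'e, 'a) lgraph \<Rightarrow> 'v set set \<Rightarrow> bool" where
  "set_finite G \<B> \<longleftrightarrow> (\<forall>A\<in>\<B>. finite (lab G ` {e \<in> edges G. src G e \<in> A}))"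

definition receiver_set_finite :: "('v, 'e, 'a) lgraph \<Rightarrow> 'v set set \<Rightarrow> bool" where
  "receiver_set_finite G \<B> \<longleftrightarrow> (\<forall>A\<in>\<B>. finite (lab G ` {e \<in> edges G. rng G e \<in> A}))"

definition incoming_labels :: "('v, 'e, 'a) lgraph \<Rightarrow> nat \<Rightarrow> 'v \<Rightarrow> 'a list set" where
  "incoming_labels G l v = plab G ` {p \<in> paths G. length p \<le> l \<and> prng G p = v}"

definition gen_vertex :: "('v, 'e, 'a) lgraph \<Rightarrow> nat \<Rightarrow> 'v \<Rightarrow> 'v set" where
  "gen_vertex G l v = {w \<in> verts G. incoming_labels G l v = incoming_labels G l w}"

text \<open>The family $\overline{\mathcal E}$. That it contains all generalized vertices is a convention
  which is not automatic from the other clauses: a source of the graph lies in no set of the form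
  $r(\alpha)$ or $r(A,\alpha)$. It is therefore built into the definition. If the smallest
  accommodating family closed under relative complements already contains the generalized
  vertices, it is equal to this one. The collection intersected here is non-empty for a labelled
  graph, as it contains the full power set of the vertex set.\<close>

definition bar_sets :: "('v, 'e, 'a) lgraph \<Rightarrow> 'v set set" where
  "bar_sets G = \<Inter> {\<B>. accommodating G \<B> \<and> (\<forall>A\<in>\<B>. \<forall>B\<in>\<B>. A - B \<in> \<B>) \<and>
     (\<forall>v\<in>verts G. \<forall>l\<ge>1. gen_vertex G l v \<in> \<B>)}"

lemma accommodating_Pow:
  assumes "labelled_graph G"
  shows "accommodating G (Pow (verts G))"
proof -
  have "prng G p \<in> verts G" if "p \<in> paths G" for p
    using assms that by (force simp: labelled_graph_def paths_def prng_def)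
  then show ?thesis
    by (auto simp: accommodating_def path_range_def rel_range_def)
qed

lemma labelled_space_bar_sets:
  assumes "labelled_graph G"
  shows "labelled_space G (bar_sets G)"
proof -
  have "bar_sets G \<subseteq> Pow (verts G)"
    unfolding bar_sets_def
    by (rule Inter_lower) (use accommodating_Pow[OF assms] in \<open>auto simp: gen_vertex_def\<close>)
  with assms show ?thesis
    by (simp add: labelled_space_def accommodating_def bar_sets_def)
qed

definition gen_vertex_inf :: "('v, 'e, 'a) lgraph \<Rightarrow> 'v \<Rightarrow> 'v set" where
  "gen_vertex_inf G v = {w \<in> verts G. \<forall>l\<ge>1. gen_vertex G l v = gen_vertex G l w}"

text \<open>The edge $e_\lambda$ is encoded as the triple of its source, label and range, which
  identifies parallel edges with equal labels.\<close>

definition merged_edge :: "('v, 'e, 'a) lgraph \<Rightarrow> 'e \<Rightarrow> 'v set \<times> 'a \<times> 'v set" where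
  "merged_edge G e = (gen_vertex_inf G (src G e), lab G e, gen_vertex_inf G (rng G e))"

definition merged_graph :: "('v, 'e, 'a) lgraph \<Rightarrow> ('v set, 'v set \<times> 'a \<times> 'v set, 'a) lgraph" where
  "merged_graph G =
     \<lparr>verts = gen_vertex_inf G ` verts G,
      edges = merged_edge G ` edges G,
      rng = (\<lambda>(_, _, R). R),
      src = (\<lambda>(S, _, _). S),
      alphabet = alphabet G,
      lab = (\<lambda>(_, a, _). a)\<rparr>"

lemma labelled_graph_merged_graph:
  assumes "labelled_graph G"
  shows "labelled_graph (merged_graph G)"
  using assms
  by (auto simp: labelled_graph_def merged_graph_def merged_edge_def image_image)

definition agreeable :: "('v, 'e, 'a) lgraph \<Rightarrow> nat \<Rightarrow> 'a list \<Rightarrow> bool" where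
  "agreeable G l \<alpha> \<longleftrightarrow>
     (\<exists>\<alpha>'\<in>labelled_paths G. \<exists>\<beta>\<in>labelled_paths G. \<exists>\<gamma>\<in>labelled_paths G.
        \<alpha> = \<beta> @ \<alpha>' \<and> \<alpha> = \<alpha>' @ \<gamma> \<and> length \<beta> = length \<gamma> \<and> length \<beta> \<le> l)"

text \<open>Disagreeability and strong cofinality of $(E,\mathcal L,\overline{\mathcal E})$ refer to the
  family $\overline{\mathcal E}$ only through the generalized vertices, hence only the labelled
  graph is an argument below.\<close>

definition disagreeable :: "('v, 'e, 'a) lgraph \<Rightarrow> bool" where
  "disagreeable G \<longleftrightarrow>
     (\<forall>v\<in>verts G. \<forall>l\<ge>1. \<exists>N\<ge>1. \<forall>n\<ge>N.
        \<exists>\<alpha>\<in>plab G ` {p \<in> paths G. n \<le> length p \<and> psrc G p \<in> gen_vertex G l v}.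
          \<not> agreeable G l \<alpha>)"

text \<open>Infinite words are indexed from 0, so $x_1\cdots x_N$ is \<open>map x [0..<N]\<close>.\<close>

definition strongly_cofinal :: "('v, 'e, 'a) lgraph \<Rightarrow> bool" where
  "strongly_cofinal G \<longleftrightarrow>
     (\<forall>x\<in>inf_labelled_paths G. \<forall>w\<in>inf_source G x. \<forall>v\<in>verts G. \<forall>l\<ge>1.
        \<exists>N\<ge>1. \<exists>\<Lambda>. finite \<Lambda> \<and> \<Lambda> \<subseteq> labelled_paths G \<and>
          rel_range G (gen_vertex G 1 w) (map x [0..<N])
            \<subseteq> (\<Union>\<mu>\<in>\<Lambda>. rel_range G (gen_vertex G l v) \<mu>))"

end

theory Submission
  imports Defs
begin

text \<open>
  Write \<open>q v\<close> for the class \<open>gen_vertex_inf E v\<close>. Everything rests on the fact that an edge of the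
  merged graph \<open>F\<close> lifts to \<open>E\<close> with \<^emph>\<open>prescribed range\<close> (\<open>edge_lift\<close>): if \<open>\<lambda>\<close> is an edge from \<open>u\<close>
  to \<open>w\<close> and \<open>q w' = q w\<close>, then an edge with the label of \<open>\<lambda>\<close> ends in \<open>w'\<close>, since \<open>w\<close> and \<open>w'\<close>
  receive the same words. Weak left-resolvingness says that a vertex determines, up to
  equivalence, the source of an incoming edge with a given label (\<open>source_class_unique\<close>); so the
  words received by \<open>w'\<close> that end in the label of \<open>\<lambda>\<close> are governed by one single source class,
  and this class is \<open>q u\<close>.

  Lifting edge by edge from the end, every finite path of \<open>F\<close> is the image of a path of \<open>E\<close> ending
  in any chosen representative of its range. Hence \<open>E\<close> and \<open>F\<close> have the same labelled paths, the
  generalized vertices of \<open>F\<close> are the images of those of \<open>E\<close>, and relative ranges of unions of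
  classes correspond under \<open>q\<close>. Disagreeability speaks of nothing else, so it agrees for both graphs.

  Strong cofinality also speaks of infinite words and the vertices at which they start. Lifts
  with prescribed range cannot be continued forwards, and here finiteness is used: a
  finite \<open>[v]\<^sub>l\<close> contains \<open>q v\<close>, so the classes along an infinite path of \<open>F\<close> are finite, and
  Koenig's lemma (\<open>koenig_layers\<close>) produces an infinite path of \<open>E\<close> above it.
\<close>

section \<open>Koenig's lemma for finite layers\<close>

text \<open>If every \<open>x\<close> failed at some \<open>f x\<close>, all would fail at the maximum of these finitely many indices.\<close>

lemma finite_witness_all:
  fixes P :: "nat \<Rightarrow> 'b \<Rightarrow> bool"
  assumes "finite A" and ex: "\<And>k. \<exists>x\<in>A. P k x"
    and mono: "\<And>k m x. P m x \<Longrightarrow> k \<le> m \<Longrightarrow> P k x"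
  shows "\<exists>x\<in>A. \<forall>k. P k x"
proof (rule ccontr)
  assume "\<not> ?thesis"
  then obtain f where f: "\<not> P (f x) x" if "x \<in> A" for x by metis
  obtain x where x: "x \<in> A" "P (Max (f ` A)) x" using ex by blast
  then have "f x \<le> Max (f ` A)" using \<open>finite A\<close> by simp
  with x f mono show False by blast
qed

primrec extends :: "(nat \<Rightarrow> 'b set) \<Rightarrow> (nat \<Rightarrow> 'b \<Rightarrow> 'b \<Rightarrow> bool) \<Rightarrow> nat \<Rightarrow> nat \<Rightarrow> 'b \<Rightarrow> bool" where
  "extends V R 0 n x \<longleftrightarrow> True"
| "extends V R (Suc k) n x \<longleftrightarrow> (\<exists>y\<in>V (Suc n). R n x y \<and> extends V R k (Suc n) y)"

lemma extends_Suc: "extends V R (Suc k) n x \<Longrightarrow> extends V R k n x"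
  by (induction k arbitrary: n x) auto

lemma extends_antimono: "k \<le> m \<Longrightarrow> extends V R m n x \<Longrightarrow> extends V R k n x"
  by (induction m rule: dec_induct) (blast dest: extends_Suc)+

text \<open>Every point has a predecessor, so chains of any finite length start in each layer; finiteness
  of the layers gives points from which chains of all lengths start, and such a point has a
  successor of the same kind.\<close>

lemma koenig_layers:
  fixes V :: "nat \<Rightarrow> 'b set"
  assumes fin: "\<And>n. finite (V n)" and ne: "\<And>n. V n \<noteq> {}"
    and pred: "\<And>n y. y \<in> V (Suc n) \<Longrightarrow> \<exists>x\<in>V n. R n x y"
  shows "\<exists>f. \<forall>n. f n \<in> V n \<and> R n (f n) (f (Suc n))"
proof -
  have ex: "\<exists>x\<in>V n. extends V R k n x" for k n
  proof (induction k arbitrary: n)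
    case 0
    then show ?case using ne by auto
  next
    case (Suc k)
    then obtain y where "y \<in> V (Suc n)" "extends V R k (Suc n) y" by blast
    with pred[of y n] show ?case by auto
  qed
  let ?good = "\<lambda>n x. x \<in> V n \<and> (\<forall>k. extends V R k n x)"
  have "\<exists>f. \<forall>n. ?good n (f n) \<and> R n (f n) (f (Suc n))"
  proof (rule dependent_nat_choice)
    have "\<exists>x\<in>V 0. \<forall>k. extends V R k 0 x"
      by (rule finite_witness_all[OF fin ex]) (rule extends_antimono)
    then show "\<exists>x. ?good 0 x" by blast
  next
    fix x n
    assume "?good n x"
    then have ex_succ: "\<exists>y\<in>V (Suc n). R n x y \<and> extends V R k (Suc n) y" for k
      by (metis extends.simps(2))
    have "\<exists>y\<in>V (Suc n). \<forall>k. R n x y \<and> extends V R k (Suc n) y"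
      by (rule finite_witness_all[OF fin ex_succ]) (use extends_antimono in metis)
    then show "\<exists>y. ?good (Suc n) y \<and> R n x y" by blast
  qed
  then show ?thesis by blast
qed

section \<open>Paths and the words received by a vertex\<close>

lemma path_Cons:
  assumes "p \<noteq> []"
  shows "e # p \<in> paths G \<longleftrightarrow> e \<in> edges G \<and> p \<in> paths G \<and> rng G e = psrc G p"
  using assms by (auto simp: paths_def psrc_def hd_conv_nth less_Suc_eq_0_disj nth_Cons split: nat.splits)

lemma path_single: "[e] \<in> paths G \<longleftrightarrow> e \<in> edges G"
  by (auto simp: paths_def)

lemma path_snoc:
  assumes "p \<noteq> []"
  shows "p @ [e] \<in> paths G \<longleftrightarrow> p \<in> paths G \<and> e \<in> edges G \<and> prng G p = src G e"
  using assms
  by (induction p rule: list_nonempty_induct)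
     (auto simp: path_Cons path_single psrc_def prng_def)

lemma psrc_in_verts: "labelled_graph G \<Longrightarrow> p \<in> paths G \<Longrightarrow> psrc G p \<in> verts G"
  by (force simp: labelled_graph_def paths_def psrc_def)

lemma prng_in_verts: "labelled_graph G \<Longrightarrow> p \<in> paths G \<Longrightarrow> prng G p \<in> verts G"
  by (force simp: labelled_graph_def paths_def prng_def)

lemma incoming_labels_0: "incoming_labels G 0 v = {}"
  by (auto simp: incoming_labels_def paths_def)

lemma incoming_label_nonempty: "\<gamma> \<in> incoming_labels G l v \<Longrightarrow> \<gamma> \<noteq> []"
  by (auto simp: incoming_labels_def paths_def plab_def)

lemma incoming_label_single:
  "[a] \<in> incoming_labels G (Suc 0) w \<longleftrightarrow> (\<exists>e\<in>edges G. lab G e = a \<and> rng G e = w)"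
proof
  assume "[a] \<in> incoming_labels G (Suc 0) w"
  then obtain p where "p \<in> paths G" "prng G p = w" "map (lab G) p = [a]"
    by (auto simp: incoming_labels_def plab_def)
  then show "\<exists>e\<in>edges G. lab G e = a \<and> rng G e = w"
    by (auto simp: map_eq_Cons_conv path_single prng_def)
next
  assume "\<exists>e\<in>edges G. lab G e = a \<and> rng G e = w"
  then obtain e where "e \<in> edges G" "lab G e = a" "rng G e = w" by blast
  then show "[a] \<in> incoming_labels G (Suc 0) w"
    unfolding incoming_labels_def
    by (intro image_eqI[of _ _ "[e]"]) (auto simp: plab_def path_single prng_def)
qed

lemma incoming_label_snoc:
  assumes "\<gamma> \<noteq> []"
  shows "\<gamma> @ [a] \<in> incoming_labels G (Suc l) w \<longleftrightarrow>
    (\<exists>e\<in>edges G. lab G e = a \<and> rng G e = w \<and> \<gamma> \<in> incoming_labels G l (src G e))"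
proof
  assume "\<gamma> @ [a] \<in> incoming_labels G (Suc l) w"
  then obtain p where p: "p \<in> paths G" "prng G p = w" "length p \<le> Suc l"
    and "map (lab G) p = \<gamma> @ [a]"
    by (auto simp: incoming_labels_def plab_def)
  then obtain p' e where "p = p' @ [e]" "map (lab G) p' = \<gamma>" "lab G e = a"
    by (auto simp: map_eq_append_conv)
  moreover from this assms have "p' \<noteq> []" by auto
  ultimately show "\<exists>e\<in>edges G. lab G e = a \<and> rng G e = w \<and> \<gamma> \<in> incoming_labels G l (src G e)"
    using p by (intro bexI[of _ e]) (auto simp: path_snoc prng_def incoming_labels_def plab_def)
next
  assume "\<exists>e\<in>edges G. lab G e = a \<and> rng G e = w \<and> \<gamma> \<in> incoming_labels G l (src G e)"
  then obtain e p where e: "e \<in> edges G" "lab G e = a" "rng G e = w"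
    and p: "p \<in> paths G" "length p \<le> l" "prng G p = src G e" "plab G p = \<gamma>"
    by (auto simp: incoming_labels_def)
  from p have "p \<noteq> []" by (auto simp: paths_def)
  with e p show "\<gamma> @ [a] \<in> incoming_labels G (Suc l) w"
    unfolding incoming_labels_def
    by (intro image_eqI[of _ _ "p @ [e]"]) (auto simp: path_snoc plab_def prng_def)
qed

lemma gen_vertex_eq_iff:
  assumes "v \<in> verts G" "w \<in> verts G"
  shows "gen_vertex G l v = gen_vertex G l w \<longleftrightarrow> incoming_labels G l v = incoming_labels G l w"
  using assms by (auto simp: gen_vertex_def)

lemma gen_vertex_inf_eq_iff:
  assumes "v \<in> verts G" "w \<in> verts G"
  shows "gen_vertex_inf G v = gen_vertex_inf G w \<longleftrightarrow>
    (\<forall>l. incoming_labels G l v = incoming_labels G l w)"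
proof -
  have "gen_vertex_inf G v = gen_vertex_inf G w \<longleftrightarrow> (\<forall>l\<ge>1. gen_vertex G l v = gen_vertex G l w)"
    using assms by (auto simp: gen_vertex_inf_def)
  also have "\<dots> \<longleftrightarrow> (\<forall>l\<ge>1. incoming_labels G l v = incoming_labels G l w)"
    using assms by (simp add: gen_vertex_eq_iff)
  also have "\<dots> \<longleftrightarrow> (\<forall>l. incoming_labels G l v = incoming_labels G l w)"
    by (metis incoming_labels_0 less_one not_le)
  finally show ?thesis .
qed

lemma in_gen_vertex_inf_iff:
  assumes "v \<in> verts G"
  shows "w \<in> gen_vertex_inf G v \<longleftrightarrow> w \<in> verts G \<and> gen_vertex_inf G w = gen_vertex_inf G v"
  using assms by (auto simp: gen_vertex_inf_def)

lemma gen_vertex_in_bar_sets: "v \<in> verts G \<Longrightarrow> 1 \<le> l \<Longrightarrow> gen_vertex G l v \<in> bar_sets G"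
  by (auto simp: bar_sets_def)

lemma finite_gen_vertex_inf:
  assumes "v \<in> verts G" "1 \<le> l" "finite (gen_vertex G l v)"
  shows "finite (gen_vertex_inf G v)"
proof (rule finite_subset[OF _ assms(3)])
  show "gen_vertex_inf G v \<subseteq> gen_vertex G l v"
    using assms by (auto simp: gen_vertex_inf_def gen_vertex_def)
qed

section \<open>Strong cofinality in terms of sources of infinite words\<close>

definition prefix_absorbed :: "('v, 'e, 'a) lgraph \<Rightarrow> (nat \<Rightarrow> 'a) \<Rightarrow> 'v \<Rightarrow> 'v \<Rightarrow> nat \<Rightarrow> bool" where
  "prefix_absorbed G x w v l \<longleftrightarrow> (\<exists>N\<ge>1. \<exists>\<Lambda>. finite \<Lambda> \<and> \<Lambda> \<subseteq> labelled_paths G \<and>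
     rel_range G (gen_vertex G 1 w) (map x [0..<N]) \<subseteq> (\<Union>\<mu>\<in>\<Lambda>. rel_range G (gen_vertex G l v) \<mu>))"

text \<open>The word may range over all sequences, because one that is not the label of an infinite path has
  no source.\<close>

lemma strongly_cofinal_iff:
  "strongly_cofinal G \<longleftrightarrow>
    (\<forall>x. \<forall>w\<in>inf_source G x. \<forall>v\<in>verts G. \<forall>l\<ge>1. prefix_absorbed G x w v l)"
proof -
  have "x \<in> inf_labelled_paths G" if "w \<in> inf_source G x" for x w
    using that by (auto simp: inf_source_def inf_labelled_paths_def)
  then show ?thesis
    unfolding strongly_cofinal_def prefix_absorbed_def[symmetric] by blast
qed

section \<open>Lifting paths from the merged graph\<close>

locale weakly_left_resolving_graph =
  fixes E :: "('v, 'e, 'a) lgraph"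
  assumes labelled_graph: "labelled_graph E"
    and weakly_left_resolving: "weakly_left_resolving E (bar_sets E)"
begin

abbreviation "F \<equiv> merged_graph E"
abbreviation "q \<equiv> gen_vertex_inf E"

lemma src_in_verts: "e \<in> edges E \<Longrightarrow> src E e \<in> verts E"
  and rng_in_verts: "e \<in> edges E \<Longrightarrow> rng E e \<in> verts E"
  using labelled_graph unfolding labelled_graph_def by blast+

lemma merged_graph_simps [simp]:
  "verts F = q ` verts E"
  "edges F = merged_edge E ` edges E"
  "src F (merged_edge E e) = q (src E e)"
  "rng F (merged_edge E e) = q (rng E e)"
  "lab F (merged_edge E e) = lab E e"
  by (simp_all add: merged_graph_def merged_edge_def)

text \<open>Two inequivalent sources would lie in disjoint generalized vertices \<open>[u\<^sub>1]\<^sub>l\<close> and \<open>[u\<^sub>2]\<^sub>l\<close>, whose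
  relative ranges under the common label must then be disjoint, yet both contain the common range.\<close>

lemma source_class_unique:
  assumes "e1 \<in> edges E" "e2 \<in> edges E" and rng: "rng E e1 = rng E e2" and lab: "lab E e1 = lab E e2"
  shows "q (src E e1) = q (src E e2)"
proof -
  have "incoming_labels E l (src E e1) = incoming_labels E l (src E e2)" for l
  proof (cases "l = 0")
    case True
    then show ?thesis by (simp add: incoming_labels_0)
  next
    case False
    let ?A = "\<lambda>e. gen_vertex E l (src E e)" and ?a = "[lab E e1]"
    have mem: "rng E e \<in> rel_range E (?A e) [lab E e]" if "e \<in> edges E" for e
      unfolding rel_range_def using that src_in_verts
      by (intro image_eqI[of _ _ "[e]"])
         (auto simp: prng_def path_single plab_def psrc_def gen_vertex_def)
    have "?a \<in> labelled_paths E"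
      unfolding labelled_paths_def using assms(1)
      by (intro image_eqI[of _ _ "[e1]"]) (auto simp: plab_def path_single)
    moreover have "?A e1 \<in> bar_sets E" "?A e2 \<in> bar_sets E"
      using False assms src_in_verts by (auto intro: gen_vertex_in_bar_sets)
    ultimately have "rel_range E (?A e1) ?a \<inter> rel_range E (?A e2) ?a = rel_range E (?A e1 \<inter> ?A e2) ?a"
      using weakly_left_resolving by (auto simp: weakly_left_resolving_def)
    with mem[OF assms(1)] mem[OF assms(2)] rng lab
    have "rel_range E (?A e1 \<inter> ?A e2) ?a \<noteq> {}" by auto
    then have "?A e1 \<inter> ?A e2 \<noteq> {}" by (auto simp: rel_range_def)
    then show ?thesis by (auto simp: gen_vertex_def)
  qed
  then show ?thesis
    using assms src_in_verts by (simp add: gen_vertex_inf_eq_iff)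
qed

text \<open>Removing the last letter recovers the words received by a source from those received by the
  range, because all competing sources are equivalent.\<close>

lemma incoming_label_src_iff:
  assumes e: "e \<in> edges E" and "\<gamma> \<noteq> []"
  shows "\<gamma> \<in> incoming_labels E l (src E e) \<longleftrightarrow>
    \<gamma> @ [lab E e] \<in> incoming_labels E (Suc l) (rng E e)"
proof -
  have "incoming_labels E l (src E e') = incoming_labels E l (src E e)"
    if "e' \<in> edges E" "lab E e' = lab E e" "rng E e' = rng E e" for e'
    using source_class_unique[OF that(1) e that(3,2)]
    by (simp add: gen_vertex_inf_eq_iff src_in_verts that(1) e)
  then show ?thesis
    unfolding incoming_label_snoc[OF assms(2)] using e by blast
qed

text \<open>An incoming edge with the right label exists because \<open>rng E e\<close> and \<open>w\<close> receive the same words of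
  length one; longer words show that its source receives the same words as the source of \<open>e\<close>.\<close>

lemma edge_lift:
  assumes e: "e \<in> edges E" and w: "w \<in> verts E" "q (rng E e) = q w"
  shows "\<exists>e'\<in>edges E. rng E e' = w \<and> merged_edge E e' = merged_edge E e"
proof -
  have eq: "incoming_labels E l (rng E e) = incoming_labels E l w" for l
    using w(2) unfolding gen_vertex_inf_eq_iff[OF rng_in_verts[OF e] w(1)] by blast
  have "[lab E e] \<in> incoming_labels E (Suc 0) w"
    using e unfolding eq[symmetric] incoming_label_single by blast
  then obtain e' where e': "e' \<in> edges E" "lab E e' = lab E e" "rng E e' = w"
    by (auto simp: incoming_label_single)
  have "incoming_labels E l (src E e') = incoming_labels E l (src E e)" for l
  proof (rule set_eqI)
    fix \<gamma>
    show "\<gamma> \<in> incoming_labels E l (src E e') \<longleftrightarrow> \<gamma> \<in> incoming_labels E l (src E e)"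
    proof (cases "\<gamma> = []")
      case True
      then show ?thesis using incoming_label_nonempty by metis
    next
      case False
      have "\<gamma> \<in> incoming_labels E l (src E e') \<longleftrightarrow> \<gamma> @ [lab E e] \<in> incoming_labels E (Suc l) w"
        using incoming_label_src_iff[OF e'(1) False] unfolding e'(2,3) .
      also have "\<dots> \<longleftrightarrow> \<gamma> \<in> incoming_labels E l (src E e)"
        using incoming_label_src_iff[OF e False] unfolding eq by (rule sym)
      finally show ?thesis .
    qed
  qed
  then have "q (src E e') = q (src E e)"
    unfolding gen_vertex_inf_eq_iff[OF src_in_verts[OF e'(1)] src_in_verts[OF e]] by blast
  with e'(2,3) w(2) have "merged_edge E e' = merged_edge E e" by (simp add: merged_edge_def)
  with e' show ?thesis by blast
qed

lemma merged_path_simps [simp]: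
  assumes "p \<in> paths E"
  shows "psrc F (map (merged_edge E) p) = q (psrc E p)"
    and "prng F (map (merged_edge E) p) = q (prng E p)"
    and "plab F (map (merged_edge E) p) = plab E p"
  using assms by (auto simp: psrc_def prng_def plab_def paths_def hd_map last_map)

lemma merged_path: "p \<in> paths E \<Longrightarrow> map (merged_edge E) p \<in> paths F"
  by (auto simp: paths_def)

lemma path_lift:
  assumes "P \<in> paths F" "w \<in> verts E" "prng F P = q w"
  shows "\<exists>p\<in>paths E. map (merged_edge E) p = P \<and> prng E p = w"
proof -
  from assms(1) have "P \<noteq> []" by (auto simp: paths_def)
  then show ?thesis using assms
  proof (induction P rule: list_nonempty_induct)
    case (single x)
    then obtain e where e: "e \<in> edges E" "x = merged_edge E e" "q (rng E e) = q w"
      by (auto simp: path_single prng_def)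
    from edge_lift[OF e(1) \<open>w \<in> verts E\<close> e(3)] obtain e' where
      e': "e' \<in> edges E" "rng E e' = w" "merged_edge E e' = x" unfolding e(2) by blast
    then show ?case
      by (intro bexI[of _ "[e']"]) (simp_all add: path_single prng_def)
  next
    case (cons x xs)
    have x: "x \<in> edges F" "xs \<in> paths F" "rng F x = psrc F xs"
      using \<open>x # xs \<in> paths F\<close> unfolding path_Cons[OF \<open>xs \<noteq> []\<close>] by blast+
    have "prng F xs = q w"
      using \<open>prng F (x # xs) = q w\<close> \<open>xs \<noteq> []\<close> by (simp add: prng_def)
    from cons.IH[OF x(2) \<open>w \<in> verts E\<close> this] obtain p
      where p: "p \<in> paths E" "map (merged_edge E) p = xs" "prng E p = w" by blast
    from x(1) obtain e where e: "e \<in> edges E" "x = merged_edge E e" by auto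
    have "q (rng E e) = q (psrc E p)"
      using x(3) merged_path_simps(1)[OF p(1)] unfolding e(2) p(2) by simp
    from edge_lift[OF e(1) psrc_in_verts[OF labelled_graph p(1)] this] obtain e' where
      e': "e' \<in> edges E" "rng E e' = psrc E p" "merged_edge E e' = x" unfolding e(2) by blast
    have "p \<noteq> []" using p(2) \<open>xs \<noteq> []\<close> by auto
    then show ?case
      using p e' by (intro bexI[of _ "e' # p"]) (simp_all add: path_Cons prng_def)
  qed
qed

lemma paths_merged: "paths F = map (merged_edge E) ` paths E"
proof
  show "paths F \<subseteq> map (merged_edge E) ` paths E"
  proof
    fix P assume P: "P \<in> paths F"
    then have "prng F P \<in> q ` verts E"
      using prng_in_verts[OF labelled_graph_merged_graph[OF labelled_graph]] by simp
    with path_lift[OF P] show "P \<in> map (merged_edge E) ` paths E" by blast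
  qed
qed (use merged_path in blast)

lemma labelled_paths_merged: "labelled_paths F = labelled_paths E"
  by (auto simp: labelled_paths_def paths_merged image_image)

section \<open>Generalized vertices and relative ranges of the merged graph\<close>

lemma incoming_labels_merged:
  assumes "w \<in> verts E"
  shows "incoming_labels F l (q w) = incoming_labels E l w"
proof (intro equalityI subsetI)
  fix \<gamma> assume "\<gamma> \<in> incoming_labels F l (q w)"
  then obtain P where P: "P \<in> paths F" "length P \<le> l" "prng F P = q w" "plab F P = \<gamma>"
    by (auto simp: incoming_labels_def)
  with path_lift assms obtain p where "p \<in> paths E" "map (merged_edge E) p = P" "prng E p = w"
    by blast
  with P show "\<gamma> \<in> incoming_labels E l w"
    by (auto simp: incoming_labels_def)
next
  fix \<gamma> assume "\<gamma> \<in> incoming_labels E l w"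
  then obtain p where p: "p \<in> paths E" "length p \<le> l" "prng E p = w" "plab E p = \<gamma>"
    by (auto simp: incoming_labels_def)
  then show "\<gamma> \<in> incoming_labels F l (q w)"
    unfolding incoming_labels_def
    by (intro image_eqI[of _ _ "map (merged_edge E) p"]) (auto simp: merged_path)
qed

lemma gen_vertex_merged:
  assumes "v \<in> verts E" "w \<in> verts E"
  shows "q w \<in> gen_vertex F l (q v) \<longleftrightarrow> w \<in> gen_vertex E l v"
  using assms by (auto simp: gen_vertex_def incoming_labels_merged)

text \<open>A path of \<open>F\<close> ending in \<open>q w\<close> lifts to one ending in \<open>w\<close> itself. Its source is known only up to
  equivalence, which is enough because a generalized vertex is a union of classes.\<close>

lemma rel_range_merged:
  assumes "v \<in> verts E" "w \<in> verts E"
  shows "q w \<in> rel_range F (gen_vertex F l (q v)) \<alpha> \<longleftrightarrow> w \<in> rel_range E (gen_vertex E l v) \<alpha>"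
proof
  assume "q w \<in> rel_range F (gen_vertex F l (q v)) \<alpha>"
  then obtain P where P: "P \<in> paths F" "plab F P = \<alpha>" "psrc F P \<in> gen_vertex F l (q v)"
    "prng F P = q w"
    by (auto simp: rel_range_def)
  with path_lift assms obtain p where p: "p \<in> paths E" "map (merged_edge E) p = P" "prng E p = w"
    by blast
  with P have "q (psrc E p) \<in> gen_vertex F l (q v)" "plab E p = \<alpha>" by auto
  with p assms psrc_in_verts[OF labelled_graph] show "w \<in> rel_range E (gen_vertex E l v) \<alpha>"
    by (auto simp: rel_range_def gen_vertex_merged)
next
  assume "w \<in> rel_range E (gen_vertex E l v) \<alpha>"
  then obtain p where p: "p \<in> paths E" "plab E p = \<alpha>" "psrc E p \<in> gen_vertex E l v" "prng E p = w"
    by (auto simp: rel_range_def)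
  with assms psrc_in_verts[OF labelled_graph]
  show "q w \<in> rel_range F (gen_vertex F l (q v)) \<alpha>"
    unfolding rel_range_def
    by (intro image_eqI[of _ _ "map (merged_edge E) p"]) (auto simp: merged_path gen_vertex_merged)
qed

lemma rel_range_subset_Union_merged_iff:
  assumes "v \<in> verts E" "w \<in> verts E"
  shows "rel_range F (gen_vertex F k (q w)) \<alpha> \<subseteq> (\<Union>\<mu>\<in>\<Lambda>. rel_range F (gen_vertex F l (q v)) \<mu>) \<longleftrightarrow>
    rel_range E (gen_vertex E k w) \<alpha> \<subseteq> (\<Union>\<mu>\<in>\<Lambda>. rel_range E (gen_vertex E l v) \<mu>)"
proof -
  have sub: "rel_range G A \<beta> \<subseteq> verts G" if "labelled_graph G" for G :: "('x, 'y, 'z) lgraph" and A \<beta>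
    using prng_in_verts[OF that] by (auto simp: rel_range_def)
  have "rel_range F A \<beta> \<subseteq> q ` verts E" for A \<beta>
    using sub[OF labelled_graph_merged_graph[OF labelled_graph]] by simp
  moreover have "rel_range E A \<beta> \<subseteq> verts E" for A \<beta>
    using sub[OF labelled_graph] .
  \<comment> \<open>Both inclusions can be tested on vertices of \<open>E\<close>, since every vertex of \<open>F\<close> has the form \<open>q y\<close>.\<close>
  ultimately have "X \<subseteq> Y \<longleftrightarrow> (\<forall>y\<in>verts E. q y \<in> X \<longrightarrow> q y \<in> Y)" "X' \<subseteq> Y' \<longleftrightarrow> (\<forall>y\<in>verts E. y \<in> X' \<longrightarrow> y \<in> Y')"
    if "X = rel_range F A \<beta>" "X' = rel_range E A' \<beta>'" for X Y X' Y' A A' \<beta> \<beta>'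
    using that by blast+
  note this[OF refl refl]
  then show ?thesis
    using assms by (simp add: rel_range_merged)
qed

section \<open>Infinite words\<close>

text \<open>The layers for Koenig's lemma are the vertices of \<open>F\<close> visited by the infinite path, read as
  classes in \<open>E\<close>; predecessors are supplied by edge lifting.\<close>

lemma inf_path_lift:
  assumes fin: "\<And>v. v \<in> verts E \<Longrightarrow> finite (q v)" and D: "D \<in> inf_paths F"
  shows "\<exists>d\<in>inf_paths E. \<forall>n. merged_edge E (d n) = D n"
proof -
  let ?R = "\<lambda>n x y. \<exists>e\<in>edges E. src E e = x \<and> rng E e = y \<and> merged_edge E e = D n"
  have "\<exists>e. e \<in> edges E \<and> D n = merged_edge E e" for n
    using D by (auto simp: inf_paths_def)
  then obtain g where g: "\<And>n. g n \<in> edges E" "\<And>n. D n = merged_edge E (g n)"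
    by metis
  have src: "src F (D n) = q (src E (g n))" and rng: "rng F (D n) = q (rng E (g n))" for n
    using g(2)[of n] by auto
  have step: "rng F (D n) = src F (D (Suc n))" for n
    using D by (auto simp: inf_paths_def)
  have "\<exists>f. \<forall>n. f n \<in> src F (D n) \<and> ?R n (f n) (f (Suc n))"
  proof (rule koenig_layers)
    fix n
    show "finite (src F (D n))" using fin g src_in_verts by (simp add: src)
    show "src F (D n) \<noteq> {}"
      using g(1) src_in_verts in_gen_vertex_inf_iff[of "src E (g n)" E] by (auto simp: src)
  next
    fix n y assume "y \<in> src F (D (Suc n))"
    then have "y \<in> q (rng E (g n))" by (simp add: step[symmetric] rng)
    then have "y \<in> verts E" "q (rng E (g n)) = q y"
      using in_gen_vertex_inf_iff rng_in_verts g(1) by metis+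
    then obtain e where e: "e \<in> edges E" "rng E e = y" "merged_edge E e = D n"
      using edge_lift[OF g(1)] g(2) by metis
    then have "src E e \<in> src F (D n)"
      using src_in_verts in_gen_vertex_inf_iff[of "src E e" E "src E e"]
      by (auto simp flip: e(3))
    with e show "\<exists>x\<in>src F (D n). ?R n x y" by blast
  qed
  then obtain f where "\<And>n. ?R n (f n) (f (Suc n))" by blast
  then obtain d where "\<And>n. d n \<in> edges E \<and> src E (d n) = f n \<and> rng E (d n) = f (Suc n) \<and>
      merged_edge E (d n) = D n" by metis
  then show ?thesis by (intro bexI[of _ d]) (auto simp: inf_paths_def)
qed

lemma merged_inf_path: "d \<in> inf_paths E \<Longrightarrow> merged_edge E \<circ> d \<in> inf_paths F"
  by (auto simp: inf_paths_def)

lemma lab_merged_comp: "lab F \<circ> (merged_edge E \<circ> d) = lab E \<circ> d"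
  by (auto simp: fun_eq_iff)

lemma inf_source_merged:
  assumes "\<And>v. v \<in> verts E \<Longrightarrow> finite (q v)"
  shows "inf_source F x = q ` inf_source E x"
proof (intro equalityI subsetI)
  fix W assume "W \<in> inf_source F x"
  then obtain D where D: "D \<in> inf_paths F" "lab F \<circ> D = x" "W = src F (D 0)"
    by (auto simp: inf_source_def)
  then obtain d where d: "d \<in> inf_paths E" "D = merged_edge E \<circ> d"
    using inf_path_lift[OF assms D(1)] by (auto simp: fun_eq_iff)
  with D show "W \<in> q ` inf_source E x"
    by (auto simp: inf_source_def lab_merged_comp)
next
  fix W assume "W \<in> q ` inf_source E x"
  then obtain d where "d \<in> inf_paths E" "lab E \<circ> d = x" "W = q (src E (d 0))"
    by (auto simp: inf_source_def)
  then show "W \<in> inf_source F x"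
    unfolding inf_source_def using merged_inf_path lab_merged_comp
    by (auto intro!: exI[of _ "merged_edge E \<circ> d"])
qed

section \<open>Invariance of the two properties\<close>

lemma prefix_absorbed_merged:
  assumes "w \<in> verts E" "v \<in> verts E"
  shows "prefix_absorbed F x (q w) (q v) l \<longleftrightarrow> prefix_absorbed E x w v l"
  unfolding prefix_absorbed_def labelled_paths_merged
    rel_range_subset_Union_merged_iff[OF assms(2,1)] by (rule refl)

lemma strongly_cofinal_merged:
  assumes fin: "\<And>v. v \<in> verts E \<Longrightarrow> finite (q v)"
  shows "strongly_cofinal F \<longleftrightarrow> strongly_cofinal E"
proof -
  have verts: "w \<in> verts E" if "w \<in> inf_source E x" for x w
    using that src_in_verts by (auto simp: inf_source_def inf_paths_def)
  have "strongly_cofinal F \<longleftrightarrow>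
      (\<forall>x. \<forall>w\<in>inf_source E x. \<forall>v\<in>verts E. \<forall>l\<ge>1. prefix_absorbed F x (q w) (q v) l)"
    by (simp add: strongly_cofinal_iff inf_source_merged[OF fin])
  also have "\<dots> \<longleftrightarrow> strongly_cofinal E"
    unfolding strongly_cofinal_iff
    by (intro all_cong1 ball_cong refl imp_cong prefix_absorbed_merged) (erule verts)
  finally show ?thesis .
qed

lemma disagreeable_merged: "disagreeable F \<longleftrightarrow> disagreeable E"
proof -
  have "plab F ` {P \<in> paths F. n \<le> length P \<and> psrc F P \<in> gen_vertex F l (q v)} =
        plab E ` {p \<in> paths E. n \<le> length p \<and> psrc E p \<in> gen_vertex E l v}"
    if "v \<in> verts E" for n l v
  proof -
    have "{P \<in> paths F. n \<le> length P \<and> psrc F P \<in> gen_vertex F l (q v)} =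
        map (merged_edge E) ` {p \<in> paths E. n \<le> length p \<and> psrc E p \<in> gen_vertex E l v}"
      using that gen_vertex_merged psrc_in_verts[OF labelled_graph] by (auto simp: paths_merged)
    then show ?thesis by (simp add: image_image)
  qed
  moreover have "agreeable F l \<alpha> \<longleftrightarrow> agreeable E l \<alpha>" for l \<alpha>
    by (simp only: agreeable_def labelled_paths_merged)
  ultimately show ?thesis
    by (simp only: disagreeable_def merged_graph_simps ball_simps cong: ball_cong)
qed

end

theorem theorem6p11:
  fixes E :: "('v, 'e, 'a) lgraph"
  assumes "labelled_space E (bar_sets E)"
    and "set_finite E (bar_sets E)"
    and "receiver_set_finite E (bar_sets E)"
    and "weakly_left_resolving E (bar_sets E)"
    and "no_sinks E"
    and "\<forall>v\<in>verts E. \<exists>l\<ge>1. finite (gen_vertex E l v)"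
  shows "(strongly_cofinal E \<longleftrightarrow> strongly_cofinal (merged_graph E)) \<and>
         (disagreeable E \<longleftrightarrow> disagreeable (merged_graph E))"
proof -
  interpret weakly_left_resolving_graph E
    by unfold_locales (use assms(1) labelled_space_def in blast, rule assms(4))
  have fin: "finite (gen_vertex_inf E v)" if v: "v \<in> verts E" for v
  proof -
    from assms(6) v obtain l where "1 \<le> l" "finite (gen_vertex E l v)" by blast
    with v show ?thesis by (rule finite_gen_vertex_inf)
  qed
  show ?thesis
    using strongly_cofinal_merged[OF fin] disagreeable_merged by blast
qed

end
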